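(* Let $n\in\mathbb{N}$, and let $t_1<t_2<\dots<t_n$ in $(-1,1)$ be the zeros of the Legendre polynomial $P_n$. Let $x_1,\dots,x_m\in[-1,1]$ and $w_1,\dots,w_m>0$ be such that the quadrature rule is exact of degree $2n-2$, i.e. $$\sum_{j=1}^m w_jf(x_j)=\int_{-1}^1f(x)\,\mathrm{d}x$$ for all algebraic polynomials $f$ of degree at most $2n-2$. Then every closed interval $[t_\ell,t_{\ell+1}]$, $\ell=1,\dots,n-1$, contains at least one of the quadrature points $x_j$, and $$\sup_{x\in[-1,1]}\inf_j|x_j-x|\le\frac{3\pi}{2n+1}.$$
   Context: $\mathbb{N}=\{1,2,\dots\}$. The Legendre polynomial is $P_n(x)=\frac{1}{2^nn!}\frac{\mathrm{d}^n}{\mathrm{d}x^n}\left((x^2-1)^n\right)$, which has $n$ simple zeros in $(-1,1)$. *)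

theory Defs
  imports "HOL-Analysis.Analysis" "HOL-Computational_Algebra.Polynomial"
begin

definition legendre :: "nat \<Rightarrow> real poly" where
  "legendre n = smult (1 / (2 ^ n * fact n)) ((pderiv ^^ n) ([:-1, 0, 1:] ^ n))"

lemma funpow_deriv_poly: "(deriv ^^ k) (poly p) = poly ((pderiv ^^ k) (p :: real poly))"
proof (induction k)
  case (Suc k)
  have "deriv (poly q) = poly (pderiv q)" for q :: "real poly"
    by (rule ext) (rule DERIV_imp_deriv[OF poly_DERIV])
  with Suc show ?case by simp
qed simp

lemma poly_legendre:
  "poly (legendre n) x = 1 / (2 ^ n * fact n) * (deriv ^^ n) (\<lambda>y. (y\<^sup>2 - 1) ^ n) x"
proof -
  have "(\<lambda>y::real. (y\<^sup>2 - 1) ^ n) = poly ([:-1, 0, 1:] ^ n)"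
    by (rule ext) (simp add: poly_power power2_eq_square)
  then show ?thesis
    by (simp add: legendre_def funpow_deriv_poly)
qed

end

(* By Sturm comparison: u = sqrt (sin \<theta>) P_n(cos \<theta>) satisfies
   u'' + ((n + 1/2)^2 + 1 / (4 sin^2 \<theta>)) u = 0, so that it oscillates faster than
   sin ((n + 1/2) \<theta>): every open interval of length h = \<pi> / (n + 1/2) inside (0, \<pi>)
   contains some \<theta> with P_n(cos \<theta>) = 0.  Hence neighbouring zeros are at most h apart, and
   the second zero from either end is within 1 - cos (2 h) < 3 h / 2 of that end.
   If no node lies in [\<alpha>, \<beta>] for two zeros \<alpha> < \<beta> of P = P_n = (X - \<alpha>) (X - \<beta>) Q, then P Q is
   nonnegative at all nodes while its integral vanishes by orthogonality, so Q vanishes at all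
   nodes; exactness for Q^2 then forces Q = 0. *)
theory Submission
  imports Defs
begin

section \<open>Legendre polynomials: differential equation and orthogonality\<close>

text \<open>With f = (X^2 - 1)^n, differentiating (X^2 - 1) f' = 2 n X f exactly k + 1 times gives
  this. The case k = n is, up to scaling, Legendre's equation.\<close>

lemma rodrigues_derivs_recurrence:
  fixes n :: nat
  defines "F \<equiv> \<lambda>k. (pderiv ^^ k) ([:-1, 0, 1:] ^ n :: real poly)"
  shows "[:-1, 0, 1:] * F (k+2) + smult (2 * real (k+1) - 2 * real n) ([:0,1:] * F (k+1))
      + smult (real ((k+1) * k) - 2 * real n * real (k+1)) (F k) = 0"
proof -
  have D: "pderiv (F j) = F (Suc j)" for j by (simp add: F_def)
  show ?thesis
  proof (induction k)
    case 0
    have "[:-1, 0, 1:] * F 1 = smult (2 * real n) ([:0,1:] * F 0)"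
    proof (cases n)
      case (Suc m)
      have "F 1 = smult (real n) ([:-1,0,1:] ^ m) * [:0,2:]"
        unfolding F_def Suc by (simp add: pderiv_power_Suc pderiv_pCons del: power_Suc of_nat_Suc)
      then show ?thesis
        by (simp add: F_def Suc poly_eq_poly_eq_iff[symmetric] fun_eq_iff algebra_simps)
    qed (simp add: F_def)
    from this[THEN arg_cong[of _ _ pderiv]] show ?case
      unfolding pderiv_mult pderiv_smult D
      by (simp add: pderiv_pCons poly_eq_poly_eq_iff[symmetric] fun_eq_iff algebra_simps)
  next
    case (Suc k)
    from Suc[THEN arg_cong[of _ _ pderiv]] show ?case
      unfolding pderiv_mult pderiv_smult pderiv_add D
      by (simp add: D pderiv_pCons poly_eq_poly_eq_iff[symmetric] fun_eq_iff algebra_simps)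
  qed
qed

lemma legendre_ode:
  fixes n :: nat and z :: real
  defines "P \<equiv> legendre n"
  shows "(1 - z\<^sup>2) * poly (pderiv (pderiv P)) z
       = 2 * z * poly (pderiv P) z - real n * (real n + 1) * poly P z"
proof -
  define F where "F \<equiv> \<lambda>k. (pderiv ^^ k) ([:-1, 0, 1:] ^ n :: real poly)"
  define c :: real where "c = 1 / (2 ^ n * fact n)"
  have D: "pderiv (F j) = F (Suc j)" for j by (simp add: F_def)
  have P: "P = smult c (F n)"
    by (simp add: P_def legendre_def F_def c_def)
  have "[:-1, 0, 1:] * F (n+2) + smult (2 * real (n+1) - 2 * real n) ([:0,1:] * F (n+1))
      + smult (real ((n+1) * n) - 2 * real n * real (n+1)) (F n) = 0"
    unfolding F_def by (rule rodrigues_derivs_recurrence)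
  from this[THEN arg_cong[of _ _ "\<lambda>p. c * poly p z"]] show ?thesis
    unfolding P pderiv_smult D by (simp add: algebra_simps power2_eq_square)
qed

lemma power_dvd_imp_power_dvd_pderiv:
  fixes p q :: "'a :: idom poly"
  assumes "q ^ Suc m dvd p"
  shows "q ^ m dvd pderiv p"
proof -
  from assms obtain r where "p = q ^ Suc m * r" by (elim dvdE)
  then have "pderiv p = q ^ m * (q * pderiv r + smult (of_nat (Suc m)) (pderiv q) * r)"
    by (simp add: pderiv_mult pderiv_power_Suc algebra_simps del: power_Suc of_nat_Suc)
       (simp add: algebra_simps)
  then show ?thesis by simp
qed

text \<open>Applied with q = X^2 - 1, this makes the derivatives of (X^2 - 1)^n of order below n
  vanish at both ends of [-1, 1].\<close>

lemma power_dvd_imp_power_dvd_funpow_pderiv: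
  fixes p q :: "'a :: idom poly"
  assumes "q ^ n dvd p" "k \<le> n"
  shows "q ^ (n - k) dvd (pderiv ^^ k) p"
  using assms(2)
proof (induction k)
  case (Suc k)
  then have "q ^ Suc (n - Suc k) dvd (pderiv ^^ k) p"
    by (simp add: Suc_diff_Suc)
  then show ?case by (simp add: power_dvd_imp_power_dvd_pderiv)
qed (use assms(1) in simp)

lemma integral_pderiv:
  fixes p :: "real poly"
  assumes "a \<le> b"
  shows "integral {a..b} (poly (pderiv p)) = poly p b - poly p a"
  using assms
  by (intro integral_unique fundamental_theorem_of_calculus)
     (auto simp flip: has_real_derivative_iff_has_vector_derivative
           intro: DERIV_subset[OF poly_DERIV])

text \<open>Integration by parts: each derivative moved from \<open>F k\<close> to \<open>g\<close>
  lowers the degree of \<open>g\<close>, and the boundary terms vanish because derivatives of order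
  below n keep a factor X^2 - 1.\<close>

lemma legendre_orthogonal:
  assumes "degree g < n"
  shows "integral {-1..1} (poly (legendre n * g)) = 0"
proof -
  define F where "F \<equiv> \<lambda>k. (pderiv ^^ k) ([:-1, 0, 1:] ^ n :: real poly)"
  have F_ends: "poly (F k) z = 0" if "k < n" "z\<^sup>2 = 1" for k z
  proof -
    have "[:-1, 0, 1:] ^ (n - k) dvd F k"
      unfolding F_def using that by (intro power_dvd_imp_power_dvd_funpow_pderiv) auto
    then have "[:-1, 0, 1:] dvd F k"
      using that(1) by (meson dvd_power dvd_trans zero_less_diff)
    then obtain r where "F k = [:-1, 0, 1:] * r" by (elim dvdE)
    then have "poly (F k) z = poly [:-1, 0, 1:] z * poly r z" by (metis poly_mult)
    then show ?thesis using that(2) by (simp add: power2_eq_square)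
  qed
  have "integral {-1..1} (poly (F k * g)) = 0" if "degree g < k" "k \<le> n" for k g
    using that
  proof (induction k arbitrary: g)
    case (Suc k)
    have "F (Suc k) * g = pderiv (F k * g) - F k * pderiv g"
      by (simp add: F_def pderiv_mult)
    then have "integral {-1..1} (poly (F (Suc k) * g)) =
        integral {-1..1} (\<lambda>z. poly (pderiv (F k * g)) z - poly (F k * pderiv g) z)"
      by (metis poly_diff)
    also have "\<dots> = integral {-1..1} (poly (pderiv (F k * g))) - integral {-1..1} (poly (F k * pderiv g))"
      by (intro integral_diff integrable_continuous_interval continuous_intros)
    also have "integral {-1..1} (poly (pderiv (F k * g))) = 0"
      using Suc.prems by (subst integral_pderiv) (auto simp: F_ends)
    also have "integral {-1..1} (poly (F k * pderiv g)) = 0"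
    \<comment> \<open>For constant \<open>g\<close> the degree does not drop, so the induction
      hypothesis might not apply; but then the integrand is zero.\<close>
    proof (cases "pderiv g = 0")
      case False
      then have "degree g \<noteq> 0" by (simp add: pderiv_eq_0_iff)
      then have "degree (pderiv g) < k" using Suc.prems by (simp add: degree_pderiv)
      then show ?thesis using Suc.prems by (intro Suc.IH) auto
    qed (simp add: poly_0[abs_def])
    finally show ?case by simp
  qed simp
  from this[of g n] assms have "integral {-1..1} (poly (F n * g)) = 0" by simp
  moreover have "poly (legendre n * g) = (\<lambda>z. 1 / (2 ^ n * fact n) * poly (F n * g) z)"
    by (simp add: fun_eq_iff legendre_def F_def)
  ultimately show ?thesis
    by (simp only: integral_mult_right mult_zero_right)
qed

lemma degree_legendre_le: "degree (legendre n) \<le> n"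
proof -
  have "degree ((pderiv ^^ k) p) = degree p - k" for k and p :: "real poly"
    by (induction k) (auto simp: degree_pderiv)
  then show ?thesis
    by (simp add: legendre_def degree_power_eq)
qed

section \<open>Sturm comparison in the angle variable, with an estimate near the endpoints\<close>

text \<open>The differentiated function is the Wronskian W = u' v - u v' of u = sqrt (sin \<theta>)
  P(cos \<theta>) and v = sin (N (\<theta> - a)). Since v'' = - N^2 v, W' = (u'' + N^2 u) v = - u v
  / (4 sin^2 \<theta>).\<close>

lemma legendre_sturm_wronskian_deriv:
  fixes n :: nat and a \<theta> :: real
  defines "P \<equiv> legendre n" and "N \<equiv> real n + 1 / 2"
  assumes "sin \<theta> > 0"
  shows "((\<lambda>\<theta>. sqrt (sin \<theta>) *
            ((cos \<theta> / (2 * sin \<theta>) * poly P (cos \<theta>) - sin \<theta> * poly (pderiv P) (cos \<theta>)) * sin (N * (\<theta> - a))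
             - N * poly P (cos \<theta>) * cos (N * (\<theta> - a))))
          has_real_derivative
          - (sqrt (sin \<theta>) / (4 * (sin \<theta>)\<^sup>2) * poly P (cos \<theta>) * sin (N * (\<theta> - a)))) (at \<theta>)"
proof -
  define s c v d r where "s = sin \<theta>" "c = cos \<theta>" "v = sin (N * (\<theta> - a))" "d = cos (N * (\<theta> - a))"
    and "r = sqrt (sin \<theta>)"
  note defs = this
  define p p1 p2 where "p = poly P c" "p1 = poly (pderiv P) c" "p2 = poly (pderiv (pderiv P)) c"
  note pdefs = this
  have s: "s > 0" using assms by (simp add: defs)
  have r: "r > 0" "s = r\<^sup>2" using assms by (simp_all add: defs)
  have cs: "c\<^sup>2 = 1 - s\<^sup>2" by (simp add: defs cos_squared_eq)
  \<comment> \<open>Legendre's equation, with n (n + 1) = N^2 - 1/4.\<close>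
  have ode: "s\<^sup>2 * p2 = 2 * c * p1 - (N\<^sup>2 - 1 / 4) * p"
    using legendre_ode[of c n, folded P_def] unfolding pdefs cs
    by (simp add: N_def power2_eq_square algebra_simps)
  \<comment> \<open>Here u' = r E and E' is the derivative of E. As r' = r c / (2 s), the expression
    computed below is (u'' + N^2 u) / r.\<close>
  define E where "E = c / (2 * s) * p - s * p1"
  define E' where "E' = ((- s * (2 * s) - c * (2 * c)) / (2 * s)\<^sup>2) * p - c / (2 * s) * (s * p1) - (c * p1 - s * (s * p2))"
  have "E' + c / (2 * s) * E + N\<^sup>2 * p
      = (s\<^sup>2 * p2 - 2 * c * p1) + (- s\<^sup>2 - c\<^sup>2) / (2 * s\<^sup>2) * p + c\<^sup>2 / (4 * s\<^sup>2) * p + N\<^sup>2 * p"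
    using s by (simp add: E'_def E_def field_simps power2_eq_square)
  also have "\<dots> = - (p / (4 * s\<^sup>2))"
    unfolding ode cs using s by (simp add: field_simps power2_eq_square)
  finally have E: "E' + c / (2 * s) * E + N\<^sup>2 * p = - (p / (4 * s\<^sup>2))" .
  have "((\<lambda>\<theta>. sqrt (sin \<theta>) *
            ((cos \<theta> / (2 * sin \<theta>) * poly P (cos \<theta>) - sin \<theta> * poly (pderiv P) (cos \<theta>)) * sin (N * (\<theta> - a))
             - N * poly P (cos \<theta>) * cos (N * (\<theta> - a))))
          has_real_derivative
          c / (2 * r) * (E * v - N * p * d) + r * (E' * v + E * (N * d) - (N * (- s * p1) * d - N * p * (N * v)))) (at \<theta>)"
    unfolding E_def E'_def pdefs defs using assms
    by (auto intro!: derivative_eq_intros simp: power2_eq_square field_simps)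
  also have "c / (2 * r) * (E * v - N * p * d) + r * (E' * v + E * (N * d) - (N * (- s * p1) * d - N * p * (N * v)))
     = r * ((E' + c / (2 * s) * E + N\<^sup>2 * p) * v + N * d * (E - c / (2 * s) * p + s * p1))"
    using r by (simp add: field_simps power2_eq_square)
  also have "\<dots> = - (r / (4 * s\<^sup>2) * p * v)"
    unfolding E by (simp add: E_def)
  finally show ?thesis by (simp add: defs pdefs)
qed

text \<open>Near an end of [-1, 1] the angular width 2 h becomes the length 1 - cos (2 h), to be
  kept below the target 3 h / 2. The estimate 2 sin^2 h \<le> 2 h^2 suffices once h < 3/4, which the
  crude bound pi < 4 yields from n = 5 on; smaller n are treated one by one.\<close>

lemma one_minus_cos_double_bound:
  fixes n :: nat
  assumes "n \<ge> 2"
  defines "h \<equiv> pi / (real n + 1 / 2)"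
  shows "1 - cos (2 * h) < 3 / 2 * h"
proof -
  have sqrt3: "sqrt 3 < 1.734" by (rule real_less_lsqrt) (auto simp: power2_eq_square)
  \<comment> \<open>The tightest case n = 2 needs 3 pi / 5 > 1.867. If pi were at most 3.12, then
    sin y \<le> y at y = pi / 24 and two double-angle steps would push cos (pi / 6) above 0.867,
    hence above sqrt 3 / 2.\<close>
  have pi_gt: "pi > 3.12"
  proof (rule ccontr)
    assume "\<not> pi > 3.12"
    then have pi_le: "pi / 24 \<le> 0.13" by simp
    have cos_ge: "cos (2 * y) \<ge> 1 - 2 * y\<^sup>2" if "y \<ge> 0" "y \<le> pi" for y :: real
      using power_mono[OF sin_x_le_x[OF that(1)] sin_ge_zero[OF that], of 2]
      by (simp add: cos_double_sin)
    have "(pi / 24)\<^sup>2 \<le> 0.13\<^sup>2" using pi_le by (intro power_mono) auto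
    then have "cos (2 * (pi / 24)) \<ge> 0.9662"
      using cos_ge[of "pi / 24"] by (simp add: power2_eq_square)
    then have "(cos (2 * (pi / 24)))\<^sup>2 \<ge> 0.9662\<^sup>2" by (intro power_mono) auto
    then have "cos (pi / 6) \<ge> 2 * 0.9662\<^sup>2 - 1"
      using cos_double_cos[of "2 * (pi / 24)"] by simp
    with sqrt3 show False by (simp add: cos_30 power2_eq_square)
  qed
  have h_pos: "h > 0" by (simp add: h_def)
  have sin_form: "1 - cos (2 * h) = 2 * (sin h)\<^sup>2" by (simp add: cos_double_sin)
  consider "n = 2" | "n = 3" | "n = 4" | "n \<ge> 5" using assms by linarith
  then show ?thesis
  proof cases
    case 1
    have "2 * h = pi - pi / 5" by (simp add: h_def 1 field_simps)
    then have "- cos (2 * h) = cos (pi / 5)" by (simp only: cos_pi_minus minus_minus)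
    also have "\<dots> < cos (pi / 6)" by (intro cos_monotone_0_pi) auto
    also have "\<dots> < 0.867"
      using sqrt3 by (simp add: cos_30)
    finally show ?thesis using pi_gt by (simp add: h_def 1)
  next
    case 2
    have "2 * h = pi / 2 + pi / 14" by (simp add: h_def 2 field_simps)
    then have "- cos (2 * h) = sin (pi / 14)" by (simp only: cos_add) simp
    also have "\<dots> \<le> pi / 14" by (rule sin_x_le_x) simp
    finally show ?thesis using pi_gt by (simp add: h_def 2)
  next
    case 3
    have "cos (2 * h) \<ge> cos (pi / 2)"
      by (intro cos_monotone_0_pi_le) (auto simp: h_def 3)
    then show ?thesis using pi_gt by (simp add: h_def 3)
  next
    case 4
    have "h \<le> pi / (5 + 1 / 2)" unfolding h_def using 4 by (intro divide_left_mono) auto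
    then have h: "h < 3 / 4" using pi_less_4 by simp
    have "sin h \<ge> 0" using h_pos h pi_gt by (intro sin_ge_zero) auto
    then have "(sin h)\<^sup>2 \<le> h\<^sup>2" using h_pos by (intro power_mono sin_x_le_x) auto
    also have "h\<^sup>2 < 3 / 4 * h" using h h_pos by (simp add: power2_eq_square)
    finally show ?thesis using sin_form by simp
  qed
qed

text \<open>If P(cos \<theta>) had constant sign \<sigma> on the interval, \<sigma> W would strictly
  decrease there. But v vanishes at both ends with slopes N and - N, so \<sigma> W is nonpositive at
  a and nonnegative at a + h.\<close>

lemma legendre_zero_in_interval:
  fixes n :: nat and a :: real
  defines "h \<equiv> pi / (real n + 1 / 2)"
  assumes "0 < a" "a + h < pi"
  shows "\<exists>\<theta>\<in>{a<..<a + h}. poly (legendre n) (cos \<theta>) = 0"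
proof (rule ccontr)
  define P where "P = legendre n"
  define N where "N = real n + 1 / 2"
  have N: "N > 0" "N * h = pi" and h: "h > 0" by (simp_all add: N_def h_def)
  assume "\<not> ?thesis"
  then have nz: "poly P (cos \<theta>) \<noteq> 0" if "a < \<theta>" "\<theta> < a + h" for \<theta>
    using that by (auto simp: P_def)
  define \<sigma> where "\<sigma> = sgn (poly P (cos (a + h / 2)))"
  have \<sigma>_neq: "\<sigma> \<noteq> 0" using nz[of "a + h / 2"] h by (simp add: \<sigma>_def sgn_zero_iff)
  have pos: "\<sigma> * poly P (cos \<theta>) > 0" if "a < \<theta>" "\<theta> < a + h" for \<theta>
  proof (rule ccontr)
    assume neg: "\<not> \<sigma> * poly P (cos \<theta>) > 0"
    let ?f = "\<lambda>\<theta>. \<sigma> * poly P (cos \<theta>)"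
    have cont: "continuous_on A ?f" for A by (intro continuous_intros)
    have mid: "?f (a + h / 2) > 0"
      using \<sigma>_neq by (simp add: \<sigma>_def sgn_if split: if_splits)
    have "\<exists>\<xi>. a < \<xi> \<and> \<xi> < a + h \<and> ?f \<xi> = 0"
    proof (cases "\<theta> \<le> a + h / 2")
      case True
      then obtain \<xi> where "\<theta> \<le> \<xi>" "\<xi> \<le> a + h / 2" "?f \<xi> = 0"
        using IVT'[of ?f \<theta> 0 "a + h / 2", OF _ _ _ cont] neg mid by auto
      then show ?thesis using that h by (intro exI[of _ \<xi>]) auto
    next
      case False
      then obtain \<xi> where "a + h / 2 \<le> \<xi>" "\<xi> \<le> \<theta>" "?f \<xi> = 0"
        using IVT2'[of ?f \<theta> 0 "a + h / 2", OF _ _ _ cont] neg mid by auto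
      then show ?thesis using that h by (intro exI[of _ \<xi>]) auto
    qed
    with nz \<sigma>_neq show False by auto
  qed
  \<comment> \<open>The ends themselves may be zeros; continuity still gives the weak sign
    there.\<close>
  have nonneg: "\<sigma> * poly P (cos \<theta>) \<ge> 0" if "a \<le> \<theta>" "\<theta> \<le> a + h" for \<theta>
  proof (rule continuous_ge_on_closure[of "{a<..<a + h}" "\<lambda>\<theta>. \<sigma> * poly P (cos \<theta>)"])
    show "\<theta> \<in> closure {a<..<a + h}" using that h by simp
  qed (use pos in \<open>auto intro!: continuous_intros less_imp_le\<close>)
  define W where "W = (\<lambda>\<theta>. sqrt (sin \<theta>) *
     ((cos \<theta> / (2 * sin \<theta>) * poly P (cos \<theta>) - sin \<theta> * poly (pderiv P) (cos \<theta>)) * sin (N * (\<theta> - a))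
       - N * poly P (cos \<theta>) * cos (N * (\<theta> - a))))"
  have sin_pos: "sin \<theta> > 0" if "a \<le> \<theta>" "\<theta> \<le> a + h" for \<theta>
    using that assms by (intro sin_gt_zero) auto
  have W': "(W has_real_derivative
      - (sqrt (sin \<theta>) / (4 * (sin \<theta>)\<^sup>2) * poly P (cos \<theta>) * sin (N * (\<theta> - a)))) (at \<theta>)"
    if "a \<le> \<theta>" "\<theta> \<le> a + h" for \<theta>
    unfolding W_def P_def N_def using sin_pos[OF that] by (rule legendre_sturm_wronskian_deriv)
  have "\<sigma> * W a > \<sigma> * W (a + h)"
  proof (rule DERIV_neg_imp_decreasing_open[where f = "\<lambda>\<theta>. \<sigma> * W \<theta>"])
    show "continuous_on {a..a + h} (\<lambda>\<theta>. \<sigma> * W \<theta>)"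
      by (intro continuous_on_mult_left DERIV_atLeastAtMost_imp_continuous_on) (use W' in blast)
  next
    fix \<theta> assume \<theta>: "a < \<theta>" "\<theta> < a + h"
    have "N * (\<theta> - a) < pi" unfolding N(2)[symmetric] using \<theta> N(1) by simp
    then have v: "sin (N * (\<theta> - a)) > 0" using \<theta> N by (intro sin_gt_zero) auto
    have "((\<lambda>\<theta>. \<sigma> * W \<theta>) has_real_derivative
       - (sqrt (sin \<theta>) / (4 * (sin \<theta>)\<^sup>2) * (\<sigma> * poly P (cos \<theta>)) * sin (N * (\<theta> - a)))) (at \<theta>)"
      using DERIV_cmult[OF W'[of \<theta>], of \<sigma>] \<theta> by (simp add: mult_ac)
    moreover have "sqrt (sin \<theta>) / (4 * (sin \<theta>)\<^sup>2) * (\<sigma> * poly P (cos \<theta>)) * sin (N * (\<theta> - a)) > 0"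
      by (rule mult_pos_pos[OF mult_pos_pos[OF divide_pos_pos pos[OF \<theta>]] v])
         (use sin_pos[of \<theta>] \<theta> in auto)
    ultimately show "\<exists>y. ((\<lambda>\<theta>. \<sigma> * W \<theta>) has_real_derivative y) (at \<theta>) \<and> y < 0"
      by (meson neg_less_0_iff_less)
  qed (use h in simp)
  moreover have "\<sigma> * W a = - (N * sqrt (sin a) * (\<sigma> * poly P (cos a)))"
    by (simp add: W_def)
  moreover have "\<sigma> * W (a + h) = N * sqrt (sin (a + h)) * (\<sigma> * poly P (cos (a + h)))"
    by (simp add: W_def N(2))
  moreover have "N * sqrt (sin \<theta>) * (\<sigma> * poly P (cos \<theta>)) \<ge> 0" if "a \<le> \<theta>" "\<theta> \<le> a + h" for \<theta>
    by (rule mult_nonneg_nonneg[OF mult_nonneg_nonneg nonneg[OF that]])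
       (use N(1) sin_pos[OF that] in auto)
  note this[of a] this[of "a + h"]
  ultimately show False using h by simp
qed

section \<open>Quadrature nodes between zeros\<close>

text \<open>Dividing out both zeros leaves Q of degree at most n - 2. This puts P Q and Q^2 within
  the exactness degree, and Q within the range of orthogonality.\<close>

lemma quadrature_node_between_zeros:
  fixes P :: "real poly" and x w :: "'i \<Rightarrow> real"
  assumes "P \<noteq> 0" "degree P \<le> n"
    and orth: "\<And>g. degree g < n \<Longrightarrow> integral {-1..1} (poly (P * g)) = 0"
    and zeros: "\<alpha> < \<beta>" "poly P \<alpha> = 0" "poly P \<beta> = 0"
    and "finite J" and w_pos: "\<And>j. j \<in> J \<Longrightarrow> w j > 0"
    and exact: "\<And>f :: real poly. degree f \<le> 2 * n - 2 \<Longrightarrow>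
           (\<Sum>j\<in>J. w j * poly f (x j)) = integral {-1..1} (poly f)"
  shows "\<exists>j\<in>J. x j \<in> {\<alpha>..\<beta>}"
proof (rule ccontr)
  assume outside: "\<not> ?thesis"
  obtain R where R: "P = [:-\<alpha>, 1:] * R"
    using zeros(2) unfolding poly_eq_0_iff_dvd by (elim dvdE)
  have "poly R \<beta> = 0" using zeros by (simp add: R)
  then obtain Q where "R = [:-\<beta>, 1:] * Q"
    unfolding poly_eq_0_iff_dvd by (elim dvdE)
  then have PQ: "P = [:-\<alpha>, 1:] * ([:-\<beta>, 1:] * Q)" by (simp add: R)
  have "Q \<noteq> 0" using assms(1) unfolding PQ by auto
  have "degree P = degree Q + 2"
    unfolding PQ using \<open>Q \<noteq> 0\<close> by (simp add: degree_mult_eq del: mult_pCons_left mult_pCons_right)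
  then have degQ: "degree Q + 2 \<le> n" using assms(2) by simp
  \<comment> \<open>P Q = (X - \<alpha>) (X - \<beta>) Q^2, and the quadratic factor is positive
    outside [\<alpha>, \<beta>].\<close>
  have nonneg: "poly (P * Q) (x j) \<ge> 0 \<and> (poly (P * Q) (x j) = 0 \<longrightarrow> poly Q (x j) = 0)" if "j \<in> J" for j
  proof -
    have PQj: "poly (P * Q) (x j) = (x j - \<alpha>) * (x j - \<beta>) * (poly Q (x j))\<^sup>2"
      by (simp add: PQ power2_eq_square algebra_simps)
    have "x j < \<alpha> \<or> x j > \<beta>" using outside that by auto
    then have "(x j - \<alpha>) * (x j - \<beta>) > 0"
      using zeros(1) by (auto intro: mult_neg_neg mult_pos_pos)
    then show ?thesis unfolding PQj by auto
  qed
  have "degree (P * Q) \<le> 2 * n - 2"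
    using degree_mult_le[of P Q] assms(2) degQ by simp
  then have "(\<Sum>j\<in>J. w j * poly (P * Q) (x j)) = 0"
    using exact[of "P * Q"] orth[of Q] degQ by simp
  then have "\<forall>j\<in>J. w j * poly (P * Q) (x j) = 0"
    using nonneg w_pos
    by (subst (asm) sum_nonneg_eq_0_iff[OF \<open>finite J\<close>])
       (auto intro!: mult_nonneg_nonneg intro: less_imp_le simp del: poly_mult)
  then have Q_nodes: "poly Q (x j) = 0" if "j \<in> J" for j
    using that nonneg w_pos by fastforce
  have "degree (Q * Q) \<le> 2 * n - 2"
    using degree_mult_le[of Q Q] degQ by simp
  then have "integral {-1..1} (poly (Q * Q)) = 0"
    by (subst exact[symmetric]) (simp_all add: Q_nodes)
  \<comment> \<open>Q^2 is continuous and nonnegative, so its zero integral gives Q infinitely many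
    roots.\<close>
  then have "\<forall>z\<in>{-1..1}. poly (Q * Q) z = 0"
    by (subst (asm) integral_eq_0_iff) (auto intro!: continuous_intros)
  then have "{-1..1} \<subseteq> {z. poly Q z = 0}" by auto
  then have "finite {-1..1::real}"
    using poly_roots_finite[OF \<open>Q \<noteq> 0\<close>] finite_subset by blast
  then show False using infinite_Icc[of "-1::real" 1] by simp
qed

section \<open>From the spacing of zeros to the distance from the nodes\<close>

lemma consecutive_bracket:
  fixes t :: "nat \<Rightarrow> 'a :: linorder"
  assumes "1 \<le> n" "t 1 \<le> y" "y < t n"
  obtains l where "l \<in> {1..n - 1}" "t l \<le> y" "y < t (l + 1)"
proof -
  have "\<exists>l\<in>{1..n - 1}. t l \<le> y \<and> y < t (l + 1)"
    using assms
  proof (induction n rule: nat_induct_at_least)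
    case (Suc n)
    then show ?case
      by (cases "y < t n") (force simp: not_less)+
  qed auto
  then show ?thesis using that by blast
qed

text \<open>Carries a bound on the angular gap of two zeros over to the zeros themselves.\<close>

lemma abs_cos_diff_le: "\<bar>cos a - cos b\<bar> \<le> \<bar>a - b :: real\<bar>"
proof -
  have "\<bar>cos a - cos b\<bar> = 2 * (\<bar>sin ((a + b) / 2)\<bar> * \<bar>sin ((b - a) / 2)\<bar>)"
    by (simp add: cos_diff_cos abs_mult)
  also have "\<dots> \<le> 2 * (1 * \<bar>(b - a) / 2\<bar>)"
    by (intro mult_left_mono mult_mono abs_sin_le_one abs_sin_x_le_abs_x) auto
  finally show ?thesis by (simp add: abs_minus_commute)
qed

theorem mainTheorem7:
  fixes n m :: nat and t x w :: "nat \<Rightarrow> real"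
  assumes "n \<ge> 1"
    and "strict_mono_on {1..n} t"
    and "t ` {1..n} = {z \<in> {-1<..<1}. poly (legendre n) z = 0}"
    and "\<And>j. j \<in> {1..m} \<Longrightarrow> x j \<in> {-1..1}"
    and "\<And>j. j \<in> {1..m} \<Longrightarrow> w j > 0"
    and "\<And>f :: real poly. degree f \<le> 2 * n - 2 \<Longrightarrow>
           (\<Sum>j=1..m. w j * poly f (x j)) = integral {-1..1} (poly f)"
  shows "(\<forall>l\<in>{1..n-1}. \<exists>j\<in>{1..m}. x j \<in> {t l..t (l+1)}) \<and>
         (SUP y\<in>{-1..1}. INF j\<in>{1..m}. \<bar>x j - y\<bar>) \<le> 3 * pi / (2 * real n + 1)"
proof (intro conjI ballI)
  have t_less: "t i < t j \<longleftrightarrow> i < j" if "i \<in> {1..n}" "j \<in> {1..n}" for i j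
    using strict_mono_on_less[OF assms(2) that] .
  have t_zero: "t i \<in> {-1<..<1}" "poly (legendre n) (t i) = 0" if "i \<in> {1..n}" for i
    using assms(3) that by blast+
  have zero_t: "\<exists>i\<in>{1..n}. z = t i" if "-1 < z" "z < 1" "poly (legendre n) z = 0" for z
    using assms(3) that by (metis (mono_tags, lifting) greaterThanLessThan_iff image_iff mem_Collect_eq)
  \<comment> \<open>The zero polynomial would vanish on all of (-1, 1), but only the finitely many
    \<open>t i\<close> are zeros there.\<close>
  have legendre_neq: "legendre n \<noteq> 0"
  proof
    assume "legendre n = 0"
    then have "{-1<..<1::real} = t ` {1..n}" unfolding assms(3) by auto
    then have "finite {-1<..<1::real}" by simp
    then show False using infinite_Ioo[of "-1::real" 1] by simp
  qed
  show node: "\<exists>j\<in>{1..m}. x j \<in> {t l..t (l+1)}" if "l \<in> {1..n-1}" for l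
    using that t_less[of l "l + 1"] t_zero[of l] t_zero[of "l + 1"]
    by (intro quadrature_node_between_zeros[of "legendre n" n _ _ _ w, OF legendre_neq degree_legendre_le
          legendre_orthogonal _ _ _ _ assms(5) assms(6)]) auto
  define h where "h = pi / (real n + 1 / 2)"
  have h_pos: "h > 0" by (simp add: h_def)
  have bound_eq: "3 * pi / (2 * real n + 1) = 3 / 2 * h"
    by (simp add: h_def field_simps)
  have theta_zero: "\<exists>\<theta>\<in>{a<..<a + h}. \<exists>i\<in>{1..n}. cos \<theta> = t i" if a: "0 < a" "a + h < pi" for a
  proof -
    obtain \<theta> where \<theta>: "\<theta> \<in> {a<..<a + h}" "poly (legendre n) (cos \<theta>) = 0"
      using legendre_zero_in_interval[of a n, folded h_def] a by blast
    have "cos \<theta> < cos 0" "cos pi < cos \<theta>"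
      using \<theta>(1) that by (intro cos_monotone_0_pi; simp)+
    then have "\<exists>i\<in>{1..n}. cos \<theta> = t i" using \<theta>(2) by (intro zero_t) auto
    then show ?thesis using \<theta>(1) by blast
  qed
  \<comment> \<open>Angles run backwards: \<open>\<tau>\<close> decreases as the index
    grows.\<close>
  define \<tau> where "\<tau> i = arccos (t i)" for i
  have \<tau>: "0 < \<tau> i" "\<tau> i < pi" "cos (\<tau> i) = t i" if "i \<in> {1..n}" for i
    using t_zero(1)[OF that] arccos_lt_bounded[of "t i"] by (auto simp: \<tau>_def)
  have cos_less: "cos \<theta> < cos \<phi>" if "\<phi> < \<theta>" "0 < \<phi>" "\<theta> < pi" for \<phi> \<theta> :: real
    using that by (intro cos_monotone_0_pi) auto
  have gap: "t (l + 1) - t l \<le> h" if l: "l \<in> {1..n-1}" for l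
  proof -
    have l': "l \<in> {1..n}" "l + 1 \<in> {1..n}" using l by auto
    \<comment> \<open>A wider angular gap would contain an interval of length h starting at
      \<open>\<tau> (l + 1)\<close>, and with it a zero strictly between two neighbours.\<close>
    have "\<tau> l \<le> \<tau> (l + 1) + h"
    proof (rule ccontr)
      assume "\<not> ?thesis"
      then obtain \<theta> i where "\<tau> (l + 1) < \<theta>" "\<theta> < \<tau> l" "i \<in> {1..n}" "cos \<theta> = t i"
        using theta_zero[of "\<tau> (l + 1)"] \<tau>[OF l'(1)] \<tau>[OF l'(2)] by force
      then have "t l < t i" "t i < t (l + 1)"
        using cos_less[of \<theta> "\<tau> l"] cos_less[of "\<tau> (l + 1)" \<theta>] \<tau>[OF l'(1)] \<tau>[OF l'(2)] by auto
      then show False using l' \<open>i \<in> {1..n}\<close> by (simp add: t_less)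
    qed
    then show ?thesis
      using abs_cos_diff_le[of "\<tau> (l + 1)" "\<tau> l"] \<tau>[OF l'(1)] \<tau>[OF l'(2)] t_less[OF l']
        cos_mono_less_eq[of "\<tau> l" "\<tau> (l + 1)"] by auto
  qed
  have close: "\<exists>j\<in>{1..m}. \<bar>x j - y\<bar> \<le> 3 / 2 * h" if y: "y \<in> {-1..1}" for y
  proof (cases "n = 1")
    case True
    \<comment> \<open>There is only one zero, so no interval between zeros to use. Exactness for the
      constant 1 shows that some node exists, and the bound is pi, which is at least the length 2 of
      [-1, 1].\<close>
    have "(\<Sum>j=1..m. w j * poly 1 (x j)) = integral {-1..1} (poly (1 :: real poly))"
      by (rule assms(6)) simp
    then have "m \<noteq> 0" by (intro notI) (simp add: poly_1[abs_def])
    moreover have "\<bar>x 1 - y\<bar> \<le> 3 / 2 * h"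
      using assms(4)[of 1] y \<open>m \<noteq> 0\<close> pi_ge_two by (auto simp: h_def True)
    ultimately show ?thesis by force
  next
    case False
    then have n: "n \<ge> 2" using assms(1) by simp
    have cos_bound: "1 - cos (2 * h) < 3 / 2 * h"
      unfolding h_def using n by (rule one_minus_cos_double_bound)
    have "h \<le> pi / (2 + 1 / 2)" unfolding h_def using n by (intro divide_left_mono) auto
    then have "5 * h \<le> 2 * pi" by simp
    then have h_lt: "2 * h < pi" using pi_gt_zero by linarith
    consider "y < t 1" | "t 1 \<le> y" "y < t n" | "t n \<le> y" by linarith
    then show ?thesis
    proof cases
      case 1
      have idx: "1 \<in> {1..n}" "2 \<in> {1..n}" using n by auto
      \<comment> \<open>For y in [-1, t 1), a node in [t 1, t 2] is within 1 + t 2 of y. Were this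
        larger than 3 h / 2, \<open>\<tau> 2\<close> would lie more than 2 h below pi, and two
        adjacent intervals of length h would give two zeros below t 2, where only t 1 lies.\<close>
      have "1 + t 2 \<le> 3 / 2 * h"
      proof (rule ccontr)
        assume "\<not> ?thesis"
        then have "cos (pi - 2 * h) < cos (\<tau> 2)" using cos_bound \<tau>(3)[OF idx(2)] by simp
        then have lt: "\<tau> 2 < pi - 2 * h"
          using \<tau>[OF idx(2)] h_lt h_pos by (subst (asm) cos_mono_less_eq) auto
        then obtain \<theta> i where i: "\<tau> 2 < \<theta>" "\<theta> < \<tau> 2 + h" "i \<in> {1..n}" "cos \<theta> = t i"
          using theta_zero[of "\<tau> 2"] \<tau>[OF idx(2)] h_pos by force
        from lt obtain \<phi> k where k: "\<tau> 2 + h < \<phi>" "\<phi> < \<tau> 2 + 2 * h" "k \<in> {1..n}" "cos \<phi> = t k"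
          using theta_zero[of "\<tau> 2 + h"] \<tau>[OF idx(2)] h_pos by force
        have "t k < t i" "t i < t 2"
          using cos_less[of \<theta> \<phi>] cos_less[of "\<tau> 2" \<theta>] i k lt \<tau>[OF idx(2)] by auto
        then show False using i(3) k(3) idx by (simp add: t_less)
      qed
      moreover have "1 \<in> {1..n - 1}" using n by simp
      from node[OF this] obtain j where "j \<in> {1..m}" "x j \<in> {t 1..t 2}"
        unfolding one_add_one by blast
      ultimately show ?thesis using 1 y by (intro bexI[of _ j]) auto
    next
      case 2
      then obtain l where l: "l \<in> {1..n - 1}" "t l \<le> y" "y < t (l + 1)"
        using consecutive_bracket[OF assms(1), of t y] by blast
      obtain j where "j \<in> {1..m}" "x j \<in> {t l..t (l + 1)}" using node[OF l(1)] by blast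
      then have "\<bar>x j - y\<bar> \<le> t (l + 1) - t l" using l by auto
      then have "\<bar>x j - y\<bar> \<le> 3 / 2 * h" using gap[OF l(1)] h_pos by linarith
      then show ?thesis using \<open>j \<in> {1..m}\<close> by blast
    next
      case 3
      have idx: "n \<in> {1..n}" "n - 1 \<in> {1..n}" using n by auto
      \<comment> \<open>Mirror image of the left end: the two adjacent intervals now end at
        \<open>\<tau> (n - 1)\<close> and would give two zeros above \<open>t (n - 1)\<close>, where
        only \<open>t n\<close> lies.\<close>
      have "1 - t (n - 1) \<le> 3 / 2 * h"
      proof (rule ccontr)
        assume "\<not> ?thesis"
        then have "cos (\<tau> (n - 1)) < cos (2 * h)" using cos_bound \<tau>(3)[OF idx(2)] by simp
        then have lt: "2 * h < \<tau> (n - 1)"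
          using \<tau>[OF idx(2)] h_lt h_pos by (subst (asm) cos_mono_less_eq) auto
        define a where "a = \<tau> (n - 1) - 2 * h"
        have a: "a > 0" "a + 2 * h < pi" using lt \<tau>[OF idx(2)] by (simp_all add: a_def)
        then obtain \<theta> i where i: "a < \<theta>" "\<theta> < a + h" "i \<in> {1..n}" "cos \<theta> = t i"
          using theta_zero[of a] h_pos by force
        from a obtain \<phi> k where k: "a + h < \<phi>" "\<phi> < a + 2 * h" "k \<in> {1..n}" "cos \<phi> = t k"
          using theta_zero[of "a + h"] h_pos by force
        have "t k < t i" "t (n - 1) < t k"
          using cos_less[of \<theta> \<phi>] cos_less[of \<phi> "\<tau> (n - 1)"] i k a h_pos \<tau>[OF idx(2)] by (auto simp: a_def)
        then show False using i(3) k(3) idx by (simp add: t_less)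
      qed
      moreover have "n - 1 \<in> {1..n - 1}" "n - 1 + 1 = n" using n by auto
      with node obtain j where "j \<in> {1..m}" "x j \<in> {t (n - 1)..t n}" by metis
      ultimately show ?thesis using 3 y by (intro bexI[of _ j]) auto
    qed
  qed
  show "(SUP y\<in>{-1..1}. INF j\<in>{1..m}. \<bar>x j - y\<bar>) \<le> 3 * pi / (2 * real n + 1)"
    unfolding bound_eq
  proof (rule cSUP_least)
    fix y :: real assume "y \<in> {-1..1}"
    from close[OF this] obtain j where j: "j \<in> {1..m}" "\<bar>x j - y\<bar> \<le> 3 / 2 * h" by blast
    \<comment> \<open>The node \<open>j\<close> also shows the finite index set to be nonempty, so
      the infimum is a true minimum.\<close>
    then show "(INF j\<in>{1..m}. \<bar>x j - y\<bar>) \<le> 3 / 2 * h"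
      by (intro cINF_lower2[of _ _ j]) auto
  qed simp
qed

end
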